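(* Every class of graphs of bounded twin-width has bounded merge-width.
   Context: Graphs are finite, simple and undirected: $G=(V,E(G))$ with $E(G)\subseteq\binom V2$. Twin-width. Two vertex sets $A,B\subseteq V(G)$ are homogeneous if all pairs $\{a,b\}$ with $a\in A,b\in B,a\ne b$ are edges of $G$, or none of them is. A contraction sequence of $G$ is a sequence of partitions of $V(G)$ starting with the partition into singletons, ending with the partition with one part, where each next partition is obtained by merging two parts into one. The red graph of a partition $\mathcal P$ has vertex set $\mathcal P$ and edges connecting the pairs of distinct parts that are not homogeneous. The twin-width of $G$ is the least $d$ such that $G$ admits a contraction sequence in which the red graph of every partition has maximum degree at most $d$. A graph class has bounded twin-width if there is $d$ such that all its graphs have twin-width at most $d$. Merge-width. A construction sequence on $V$ is a sequence of steps maintaining a partition $\mathcal P$ of $V$ and a partition of $\binom V2$ into edges $E$, non-edges $N$, and unresolved pairs $U$. Initially $\mathcal P$ is the partition into singletons and $U=\binom V2$. In each step one of three operations is performed: merge two parts $A,B\in\mathcal P$, replacing them by $A\cup B$; resolve positively a pair of parts $A,B\in\mathcal P$ (possibly $A=B$), moving all $\{a,b\}\in U$ with $a\in A,b\in B$ from $U$ to $E$; or resolve negatively such a pair of parts, moving these pairs from $U$ to $N$. In the end $\mathcal P$ has one part and $U=\emptyset$; it is then a construction sequence of the graph $(V,E)$. Its radius-$r$ width is the least $k$ such that at every step, for every $v\in V$, at most $k$ parts of the current $\mathcal P$ contain a vertex reachable from $v$ by a path of length at most $r$ in the graph $(V,E\cup N)$ for the current $E,N$. The radius-$r$ merge-width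 $\mathrm{mw}_r(G)$ is the least radius-$r$ width of a construction sequence of $G$. A graph class $\mathcal C$ has bounded merge-width if $\sup_{G\in\mathcal C}\mathrm{mw}_r(G)<\infty$ for every $r\in\mathbb N$. *)

theory Defs
  imports "HOL-Library.Ramsey" "HOL-Library.Extended_Nat"
begin

section \<open>Graphs\<close>

record 'a graph =
  verts :: "'a set"
  edges :: "'a set set"

definition simple_graph :: "'a graph \<Rightarrow> bool" where
  "simple_graph G \<longleftrightarrow> finite (verts G) \<and> edges G \<subseteq> [verts G]\<^bsup>2\<^esup>"

definition path_between :: "'a graph \<Rightarrow> 'a \<Rightarrow> 'a list \<Rightarrow> 'a \<Rightarrow> bool" where
  "path_between G u p v \<longleftrightarrow>
     p \<noteq> [] \<and> hd p = u \<and> last p = v \<and> set p \<subseteq> verts G \<and> distinct p \<and>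
     successively (\<lambda>x y. {x, y} \<in> edges G) p"

(* A path given by its list p of vertices has length (number of edges) length p - 1. *)
definition reachable_within :: "'a graph \<Rightarrow> nat \<Rightarrow> 'a \<Rightarrow> 'a \<Rightarrow> bool" where
  "reachable_within G r u v \<longleftrightarrow> (\<exists>p. path_between G u p v \<and> length p \<le> r + 1)"

section \<open>Partitions under merging\<close>

definition singletons :: "'a set \<Rightarrow> 'a set set" where
  "singletons V = {{v} | v. v \<in> V}"

definition merges_to :: "'a set set \<Rightarrow> 'a set set \<Rightarrow> bool" where
  "merges_to P P' \<longleftrightarrow> (\<exists>A\<in>P. \<exists>B\<in>P. A \<noteq> B \<and> P' = insert (A \<union> B) (P - {A, B}))"

(* The partition with one part. The empty set has only the empty partition, so for the graph
   without vertices that partition has to be admitted here; for nonempty V the condition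
   says P = {V}. *)
definition trivial_partition :: "'a set \<Rightarrow> 'a set set \<Rightarrow> bool" where
  "trivial_partition V P \<longleftrightarrow> P = (if V = {} then {} else {V})"

section \<open>Twin-width\<close>

definition homogeneous :: "'a graph \<Rightarrow> 'a set \<Rightarrow> 'a set \<Rightarrow> bool" where
  "homogeneous G A B \<longleftrightarrow>
     (\<forall>a\<in>A. \<forall>b\<in>B. a \<noteq> b \<longrightarrow> {a, b} \<in> edges G) \<or>
     (\<forall>a\<in>A. \<forall>b\<in>B. a \<noteq> b \<longrightarrow> {a, b} \<notin> edges G)"

definition red_graph :: "'a graph \<Rightarrow> 'a set set \<Rightarrow> 'a set graph" where
  "red_graph G P =
     \<lparr>verts = P, edges = {{A, B} | A B. A \<in> P \<and> B \<in> P \<and> A \<noteq> B \<and> \<not> homogeneous G A B}\<rparr>"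

definition degree :: "'a graph \<Rightarrow> 'a \<Rightarrow> nat" where
  "degree G v = card {e \<in> edges G. v \<in> e}"

definition contraction_sequence :: "'a graph \<Rightarrow> 'a set set list \<Rightarrow> bool" where
  "contraction_sequence G Ps \<longleftrightarrow>
     Ps \<noteq> [] \<and> hd Ps = singletons (verts G) \<and> trivial_partition (verts G) (last Ps) \<and>
     successively merges_to Ps"

definition red_degree_at_most :: "'a graph \<Rightarrow> 'a set set list \<Rightarrow> nat \<Rightarrow> bool" where
  "red_degree_at_most G Ps d \<longleftrightarrow>
     (\<forall>P\<in>set Ps. \<forall>A\<in>verts (red_graph G P). degree (red_graph G P) A \<le> d)"

(* The infimum over the extended naturals is a minimum, with value infinity if there is no
   suitable d; the same encoding is used for merge-width. *)
definition twin_width :: "'a graph \<Rightarrow> enat" where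
  "twin_width G =
     (INF d \<in> {d. \<exists>Ps. contraction_sequence G Ps \<and> red_degree_at_most G Ps d}. enat d)"

definition bounded_twin_width :: "'a graph set \<Rightarrow> bool" where
  "bounded_twin_width \<C> \<longleftrightarrow> (\<exists>d::nat. \<forall>G\<in>\<C>. twin_width G \<le> enat d)"

section \<open>Merge-width\<close>

record 'a cstate =
  parts :: "'a set set"
  pos :: "'a set set"
  neg :: "'a set set"
  unres :: "'a set set"

definition initial_state :: "'a set \<Rightarrow> 'a cstate" where
  "initial_state V = \<lparr>parts = singletons V, pos = {}, neg = {}, unres = [V]\<^bsup>2\<^esup>\<rparr>"

definition unres_between :: "'a cstate \<Rightarrow> 'a set \<Rightarrow> 'a set \<Rightarrow> 'a set set" where
  "unres_between S A B = {{a, b} | a b. a \<in> A \<and> b \<in> B \<and> {a, b} \<in> unres S}"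

inductive construction_step :: "'a cstate \<Rightarrow> 'a cstate \<Rightarrow> bool" where
  merge: "merges_to (parts S) P' \<Longrightarrow> construction_step S (S\<lparr>parts := P'\<rparr>)"
| resolve_pos: "A \<in> parts S \<Longrightarrow> B \<in> parts S \<Longrightarrow>
    construction_step S
      (S\<lparr>pos := pos S \<union> unres_between S A B, unres := unres S - unres_between S A B\<rparr>)"
| resolve_neg: "A \<in> parts S \<Longrightarrow> B \<in> parts S \<Longrightarrow>
    construction_step S
      (S\<lparr>neg := neg S \<union> unres_between S A B, unres := unres S - unres_between S A B\<rparr>)"

definition construction_sequence :: "'a graph \<Rightarrow> 'a cstate list \<Rightarrow> bool" where
  "construction_sequence G Ss \<longleftrightarrow>
     Ss \<noteq> [] \<and> hd Ss = initial_state (verts G) \<and> successively construction_step Ss \<and>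
     trivial_partition (verts G) (parts (last Ss)) \<and> unres (last Ss) = {} \<and>
     pos (last Ss) = edges G"

definition resolved_graph :: "'a set \<Rightarrow> 'a cstate \<Rightarrow> 'a graph" where
  "resolved_graph V S = \<lparr>verts = V, edges = pos S \<union> neg S\<rparr>"

definition reachable_parts :: "'a set \<Rightarrow> nat \<Rightarrow> 'a cstate \<Rightarrow> 'a \<Rightarrow> 'a set set" where
  "reachable_parts V r S v =
     {A \<in> parts S. \<exists>u\<in>A. reachable_within (resolved_graph V S) r v u}"

definition radius_width_at_most :: "'a set \<Rightarrow> nat \<Rightarrow> 'a cstate list \<Rightarrow> nat \<Rightarrow> bool" where
  "radius_width_at_most V r Ss k \<longleftrightarrow>
     (\<forall>S\<in>set Ss. \<forall>v\<in>V. card (reachable_parts V r S v) \<le> k)"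

definition merge_width :: "nat \<Rightarrow> 'a graph \<Rightarrow> enat" where
  "merge_width r G =
     (INF k \<in> {k. \<exists>Ss. construction_sequence G Ss \<and> radius_width_at_most (verts G) r Ss k}. enat k)"

definition bounded_merge_width :: "'a graph set \<Rightarrow> bool" where
  "bounded_merge_width \<C> \<longleftrightarrow> (\<forall>r::nat. (SUP G\<in>\<C>. merge_width r G) < \<infinity>)"

end

theory Submission
  imports Defs "HOL-Library.Disjoint_Sets"
begin

text \<open>
  A contraction sequence becomes a construction sequence once it is decided which pairs of vertices are resolved at
  each of its partitions \<open>P\<close>. The choice made here is to resolve exactly the pairs that lie inside one
  part of \<open>P\<close> or between two parts that are adjacent in the red graph (\<open>close_pairs\<close>). No
  pair is close for singletons, and every pair is close when a single part is left, so the two ends are as a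
  construction sequence requires.

  When \<open>P\<close> is coarsened to \<open>P'\<close>, a close pair stays close, because parts that contain a
  non-homogeneous pair of parts are equal or again non-homogeneous. A pair that becomes close lies between two
  parts of \<open>P\<close> that are homogeneous, and then all pairs between these parts become close together
  (\<open>close_pairs_coarsening\<close>). Hence positive and negative resolutions between parts of
  \<open>P\<close> suffice to resolve them correctly before the merge is performed.

  The width is small because the resolved graph is controlled by the red graph. During all these steps only pairs
  that are close for \<open>P'\<close> are resolved, so a path of length at most \<open>r\<close> moves through the
  parts of \<open>P'\<close> along red edges, and it ends in the red ball of radius \<open>r\<close> around the
  part where it starts (\<open>walk_in_red_ball\<close>). If the red degree is at most \<open>d\<close>, this ball
  has at most \<open>(d + 1) ^ r\<close> parts. Each of them contains at most two parts of the partition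
  \<open>P\<close> before the merge, so the radius-\<open>r\<close> width is at most
  \<open>2 * (d + 1) ^ r\<close>, a bound that depends only on \<open>d\<close> and \<open>r\<close>.
\<close>

section \<open>Balls in the red graph\<close>

definition red_neighbours :: "'a graph \<Rightarrow> 'a set set \<Rightarrow> 'a set \<Rightarrow> 'a set set" where
  "red_neighbours G P A = {B \<in> P. B \<noteq> A \<and> \<not> homogeneous G A B}"

lemma homogeneous_sym:
  fixes G :: "'a graph"
  shows "homogeneous G A B \<longleftrightarrow> homogeneous G B A"
proof -
  have "{a, b} = {b, a}" for a b :: 'a
    by blast
  then have "(\<forall>a\<in>A. \<forall>b\<in>B. a \<noteq> b \<longrightarrow> Q {a, b}) \<longleftrightarrow> (\<forall>b\<in>B. \<forall>a\<in>A. b \<noteq> a \<longrightarrow> Q {b, a})"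
    for Q :: "'a set \<Rightarrow> bool" and A B
    by metis
  from this[of A B "\<lambda>e. e \<in> edges G"] this[of A B "\<lambda>e. e \<notin> edges G"] show ?thesis
    by (simp only: homogeneous_def)
qed

lemma homogeneous_mono:
  "homogeneous G A' B' \<Longrightarrow> A \<subseteq> A' \<Longrightarrow> B \<subseteq> B' \<Longrightarrow> homogeneous G A B"
  unfolding homogeneous_def by blast

lemma card_red_neighbours:
  assumes "A \<in> P"
  shows "card (red_neighbours G P A) = degree (red_graph G P) A"
proof -
  have "{e \<in> edges (red_graph G P). A \<in> e} = (\<lambda>B. {A, B}) ` red_neighbours G P A"
    using assms homogeneous_sym[of G]
    by (fastforce simp: red_graph_def red_neighbours_def image_iff insert_commute)
  moreover have "inj_on (\<lambda>B. {A, B}) (red_neighbours G P A)"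
    by (auto simp: inj_on_def doubleton_eq_iff)
  ultimately show ?thesis
    by (simp add: degree_def card_image)
qed

text \<open>The centre is kept in each step, so that a walk may also spend steps inside one part and may be
  shorter than the radius.\<close>

fun red_ball :: "'a graph \<Rightarrow> 'a set set \<Rightarrow> nat \<Rightarrow> 'a set \<Rightarrow> 'a set set" where
  "red_ball G P 0 A = {A}"
| "red_ball G P (Suc n) A = (\<Union>B\<in>insert A (red_neighbours G P A). red_ball G P n B)"

lemma red_ball_centre: "A \<in> red_ball G P n A"
  by (induction n) auto

lemma finite_red_ball: "finite P \<Longrightarrow> finite (red_ball G P n A)"
  by (induction n arbitrary: A) (auto simp: red_neighbours_def)

lemma card_red_ball:
  assumes "finite P" "A \<in> P"
    and deg: "\<And>A. A \<in> P \<Longrightarrow> card (red_neighbours G P A) \<le> d"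
  shows "card (red_ball G P n A) \<le> (d + 1) ^ n"
  using \<open>A \<in> P\<close>
proof (induction n arbitrary: A)
  case (Suc n)
  let ?N = "insert A (red_neighbours G P A)"
  have fin: "finite ?N"
    using \<open>finite P\<close> by (simp add: red_neighbours_def)
  have "card (red_ball G P (Suc n) A) \<le> (\<Sum>B\<in>?N. card (red_ball G P n B))"
    using card_UN_le[OF fin] by simp
  also have "\<dots> \<le> card ?N * (d + 1) ^ n"
    using Suc by (intro sum_bounded_above[where 'a = nat, simplified]) (auto simp: red_neighbours_def)
  also have "\<dots> \<le> (d + 1) * (d + 1) ^ n"
    using deg[OF Suc.prems] card_insert_le_m1[of "d + 1" "red_neighbours G P A" A]
    by (intro mult_right_mono) auto
  finally show ?case
    by simp
qed simp

lemma red_ball_subset: "A \<in> P \<Longrightarrow> red_ball G P n A \<subseteq> P"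
proof (induction n arbitrary: A)
  case (Suc n)
  have "B \<in> P" if "B \<in> insert A (red_neighbours G P A)" for B
    using that Suc.prems by (auto simp: red_neighbours_def)
  then show ?case
    using Suc.IH by fastforce
qed simp

section \<open>States determined by a set of resolved pairs\<close>

definition pairs_between :: "'a set \<Rightarrow> 'a set \<Rightarrow> 'a set set" where
  "pairs_between A B = {{a, b} | a b. a \<in> A \<and> b \<in> B \<and> a \<noteq> b}"

definition close_pairs :: "'a graph \<Rightarrow> 'a set set \<Rightarrow> 'a set set" where
  "close_pairs G P =
     (\<Union>A\<in>P. \<Union>B\<in>{B \<in> P. A = B \<or> \<not> homogeneous G A B}. pairs_between A B)"

text \<open>All resolutions performed below agree with \<open>G\<close>, so the set \<open>R\<close> of resolved pairs already
  determines which pairs are positive and which are negative.\<close>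

definition state :: "'a graph \<Rightarrow> 'a set set \<Rightarrow> 'a set set \<Rightarrow> 'a cstate" where
  "state G P R = \<lparr>parts = P, pos = R \<inter> edges G, neg = R - edges G, unres = [verts G]\<^bsup>2\<^esup> - R\<rparr>"

lemma nsets2_eq_pairs_between: "[V]\<^bsup>2\<^esup> = pairs_between V V"
  by (auto simp: pairs_between_def nsets_2_eq)

lemma close_pairs_singletons: "close_pairs G (singletons V) = {}"
proof -
  have "pairs_between {u} {u} = {}" "homogeneous G {u} {v}" for u v
    by (auto simp: pairs_between_def homogeneous_def)
  then show ?thesis
    by (auto simp: close_pairs_def singletons_def)
qed

lemma close_pairs_trivial:
  assumes "trivial_partition V P"
  shows "close_pairs G P = [V]\<^bsup>2\<^esup>"
proof (cases "V = {}")
  case True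
  with assms show ?thesis
    by (simp add: close_pairs_def trivial_partition_def nsets2_eq_pairs_between pairs_between_def)
next
  case False
  with assms have "P = {V}"
    by (simp add: trivial_partition_def)
  moreover have "{B \<in> {V}. V = B \<or> \<not> homogeneous G V B} = {V}"
    by blast
  ultimately show ?thesis
    by (simp add: close_pairs_def nsets2_eq_pairs_between)
qed

lemma partition_part_unique:
  "partition_on V P \<Longrightarrow> A \<in> P \<Longrightarrow> B \<in> P \<Longrightarrow> a \<in> A \<Longrightarrow> a \<in> B \<Longrightarrow> A = B"
  by (auto dest: partition_onD2 disjointD)

lemma close_pairs_part:
  assumes P: "partition_on V P" and "{a, b} \<in> close_pairs G P"
    and A: "a \<in> A" "A \<in> P"
  obtains B where "b \<in> B" "B \<in> insert A (red_neighbours G P A)"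
proof -
  obtain X Y where XY: "X \<in> P" "Y \<in> P" "X = Y \<or> \<not> homogeneous G X Y" "{a, b} \<in> pairs_between X Y"
    using assms(2) unfolding close_pairs_def by auto
  then consider "a \<in> X" "b \<in> Y" | "a \<in> Y" "b \<in> X"
    unfolding pairs_between_def by (auto simp: doubleton_eq_iff)
  then show thesis
  proof cases
    case 1
    then have "X = A"
      using partition_part_unique[OF P] XY A by blast
    with 1 XY that[of Y] show thesis
      by (auto simp: red_neighbours_def)
  next
    case 2
    then have "Y = A"
      using partition_part_unique[OF P] XY A by blast
    with 2 XY that[of X] show thesis
      by (auto simp: red_neighbours_def homogeneous_sym)
  qed
qed

text \<open>Each step of the walk stays in its part or crosses to a red neighbour, so the parts that it
  visits follow a walk in the red graph that is no longer.\<close>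

lemma walk_in_red_ball:
  assumes P: "partition_on V P" and "R \<subseteq> close_pairs G P" and B: "B \<in> P"
    and "p \<noteq> []" "successively (\<lambda>x y. {x, y} \<in> R) p" "length p \<le> n + 1"
    and "hd p \<in> A" "A \<in> P" "last p \<in> B"
  shows "B \<in> red_ball G P n A"
  using assms(4-)
proof (induction p arbitrary: n A)
  case (Cons x q)
  show ?case
  proof (cases q)
    case Nil
    then have "A = B"
      using partition_part_unique[OF P _ B] Cons.prems by simp
    then show ?thesis
      by (simp add: red_ball_centre)
  next
    case q: (Cons y q')
    then obtain m where n: "n = Suc m"
      using Cons.prems by (cases n) auto
    have "{x, y} \<in> close_pairs G P"
      using Cons.prems q assms(2) by auto
    then obtain C where C: "y \<in> C" "C \<in> insert A (red_neighbours G P A)"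
      using close_pairs_part[OF P, of x y G A] Cons.prems by auto
    then have "C \<in> P"
      using Cons.prems by (auto simp: red_neighbours_def)
    then have "B \<in> red_ball G P m C"
      using Cons.prems C q n by (intro Cons.IH) auto
    then show ?thesis
      using C n by auto
  qed
qed simp

text \<open>The partition \<open>P\<close> of the state may be finer than the partition \<open>P'\<close> whose red graph
  controls the resolved pairs. This covers the states before a merge, in which pairs are already
  resolved for the sake of the next partition.\<close>

lemma card_reachable_parts:
  assumes P': "partition_on (verts G) P'" "finite P'"
    and deg: "\<And>A. A \<in> P' \<Longrightarrow> card (red_neighbours G P' A) \<le> d"
    and R: "R \<subseteq> close_pairs G P'"
    and P: "finite P" "\<And>X. X \<in> P \<Longrightarrow> \<exists>Y\<in>P'. X \<subseteq> Y"
    and fibre: "\<And>Y. Y \<in> P' \<Longrightarrow> card {X \<in> P. X \<subseteq> Y} \<le> c"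
    and "v \<in> verts G"
  shows "card (reachable_parts (verts G) r (state G P R) v) \<le> c * (d + 1) ^ r"
proof -
  obtain A where A: "A \<in> P'" "v \<in> A"
    using P'(1) \<open>v \<in> verts G\<close> by (auto dest: partition_onD1)
  let ?B = "red_ball G P' r A"
  have resolved: "pos (state G P R) \<union> neg (state G P R) = R"
    by (auto simp: state_def)
  have "reachable_parts (verts G) r (state G P R) v \<subseteq> (\<Union>Y\<in>?B. {X \<in> P. X \<subseteq> Y})"
  proof
    fix X assume "X \<in> reachable_parts (verts G) r (state G P R) v"
    then obtain u p where X: "X \<in> P" "u \<in> X"
      and p: "p \<noteq> []" "hd p = v" "last p = u" "successively (\<lambda>x y. {x, y} \<in> R) p" "length p \<le> r + 1"
      by (auto simp: reachable_parts_def reachable_within_def path_between_def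
          resolved_graph_def resolved) (auto simp: state_def)
    obtain Y where Y: "Y \<in> P'" "X \<subseteq> Y"
      using P(2) X(1) by blast
    have "Y \<in> ?B"
      by (rule walk_in_red_ball[OF P'(1) R Y(1) p(1) p(4) p(5)]) (use X Y A p in auto)
    with X Y show "X \<in> (\<Union>Y\<in>?B. {X \<in> P. X \<subseteq> Y})"
      by blast
  qed
  then have "card (reachable_parts (verts G) r (state G P R) v) \<le> card (\<Union>Y\<in>?B. {X \<in> P. X \<subseteq> Y})"
    using P(1) P'(2) by (intro card_mono) (auto simp: finite_red_ball)
  also have "\<dots> \<le> (\<Sum>Y\<in>?B. card {X \<in> P. X \<subseteq> Y})"
    by (intro card_UN_le finite_red_ball P')
  also have "\<dots> \<le> card ?B * c"
    using sum_bounded_above[of ?B "\<lambda>Y. card {X \<in> P. X \<subseteq> Y}" c] fibre red_ball_subset[OF A(1)]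
    by (auto simp: subset_iff)
  also have "\<dots> \<le> (d + 1) ^ r * c"
    using P' A deg by (intro mult_right_mono card_red_ball) auto
  finally show ?thesis
    by (simp add: mult.commute)
qed

section \<open>Resolving pairs of homogeneous parts\<close>

text \<open>Homogeneity makes one resolution, of the appropriate sign, agree with \<open>G\<close> on all pairs
  between the two parts; pairs that were resolved before are left alone by it.\<close>

lemma resolve_homogeneous:
  assumes "\<Union>P \<subseteq> verts G" "A \<in> P" "B \<in> P" "homogeneous G A B"
  shows "construction_step (state G P R) (state G P (R \<union> pairs_between A B))"
proof -
  let ?S = "state G P R" and ?T = "state G P (R \<union> pairs_between A B)"
  have "A \<subseteq> verts G" "B \<subseteq> verts G"
    using assms by auto
  then have U: "unres_between ?S A B = pairs_between A B - R"
    by (auto simp: unres_between_def state_def pairs_between_def)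
  consider "pairs_between A B \<subseteq> edges G" | "pairs_between A B \<inter> edges G = {}"
    using assms(4) unfolding homogeneous_def pairs_between_def by blast
  then show ?thesis
  proof cases
    case 1
    then have "?T = ?S\<lparr>pos := pos ?S \<union> unres_between ?S A B, unres := unres ?S - unres_between ?S A B\<rparr>"
      unfolding U by (auto simp: state_def)
    then show ?thesis
      using resolve_pos[of A ?S B] assms by (simp add: state_def)
  next
    case 2
    then have "?T = ?S\<lparr>neg := neg ?S \<union> unres_between ?S A B, unres := unres ?S - unres_between ?S A B\<rparr>"
      unfolding U by (auto simp: state_def)
    then show ?thesis
      using resolve_neg[of A ?S B] assms by (simp add: state_def)
  qed
qed

text \<open>Only the states that are reached are constrained by \<open>Q\<close>; the initial one is treated separately
  when the steps are collected in a list.\<close>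

abbreviation steps_within :: "('a cstate \<Rightarrow> bool) \<Rightarrow> 'a cstate \<Rightarrow> 'a cstate \<Rightarrow> bool" where
  "steps_within Q \<equiv> (\<lambda>S T. construction_step S T \<and> Q T)\<^sup>*\<^sup>*"

lemma resolve_homogeneous_pairs:
  assumes "finite F" "\<Union>P \<subseteq> verts G"
    and "\<And>A B. (A, B) \<in> F \<Longrightarrow> A \<in> P \<and> B \<in> P \<and> homogeneous G A B"
    and "\<And>R'. R' \<subseteq> R \<union> (\<Union>(A, B)\<in>F. pairs_between A B) \<Longrightarrow> Q (state G P R')"
  shows "steps_within Q (state G P R) (state G P (R \<union> (\<Union>(A, B)\<in>F. pairs_between A B)))"
  using assms
proof (induction F)
  case (insert f F)
  obtain A B where f: "f = (A, B)"
    by (cases f)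
  let ?R = "R \<union> (\<Union>(A, B)\<in>F. pairs_between A B)"
  have "steps_within Q (state G P R) (state G P ?R)"
  proof (rule insert.IH[OF insert.prems(1)])
    show "Q (state G P R')" if "R' \<subseteq> ?R" for R'
      using that by (intro insert.prems(3)) auto
  qed (use insert.prems(2) in auto)
  moreover have "construction_step (state G P ?R) (state G P (?R \<union> pairs_between A B))"
    using insert.prems(2)[of A B] f by (intro resolve_homogeneous insert.prems(1)) auto
  moreover have "?R \<union> pairs_between A B = R \<union> (\<Union>(A, B)\<in>insert f F. pairs_between A B)"
    using f by auto
  ultimately show ?case
    using insert.prems(3) by (auto intro: rtranclp.rtrancl_into_rtrancl)
qed simp

text \<open>Resolutions act on whole pairs of parts of \<open>P\<close>. This is enough to reach the close pairs of
  \<open>P'\<close> exactly: closeness for \<open>P'\<close> depends only on the parts of \<open>P'\<close> that contain the two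
  vertices, so if one pair between parts \<open>A\<close> and \<open>B\<close> of \<open>P\<close> is close for \<open>P'\<close>, then all are.\<close>

lemma close_pairs_coarsening:
  fixes G :: "'a graph"
  assumes "\<Union>P' \<subseteq> \<Union>P" and P': "partition_on V P'"
    and coarse: "\<And>X. X \<in> P \<Longrightarrow> \<exists>Y\<in>P'. X \<subseteq> Y"
  defines "F \<equiv> {(A, B). A \<in> P \<and> B \<in> P \<and> homogeneous G A B \<and> pairs_between A B \<subseteq> close_pairs G P'}"
  shows "close_pairs G P' = close_pairs G P \<union> (\<Union>(A, B)\<in>F. pairs_between A B)"
proof
  show "close_pairs G P' \<subseteq> close_pairs G P \<union> (\<Union>(A, B)\<in>F. pairs_between A B)"
  proof
    fix e assume "e \<in> close_pairs G P'"
    then obtain X Y a b where XY: "X \<in> P'" "Y \<in> P'" "X = Y \<or> \<not> homogeneous G X Y"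
      and e: "e = {a, b}" "a \<in> X" "b \<in> Y" "a \<noteq> b"
      by (auto simp: close_pairs_def pairs_between_def)
    show "e \<in> close_pairs G P \<union> (\<Union>(A, B)\<in>F. pairs_between A B)"
    proof -
      obtain A B where AB: "A \<in> P" "B \<in> P" "a \<in> A" "b \<in> B"
        using assms(1) XY e by blast
      then have sub: "A \<subseteq> X" "B \<subseteq> Y"
        using XY e coarse[of A] coarse[of B] partition_part_unique[OF P'] by blast+
      have "pairs_between A B \<subseteq> close_pairs G P'"
      proof -
        have "pairs_between A B \<subseteq> pairs_between X Y"
          using sub by (auto simp: pairs_between_def)
        then show ?thesis
          using XY by (auto simp: close_pairs_def)
      qed
      moreover have "e \<in> pairs_between A B"
        using AB e by (auto simp: pairs_between_def)
      ultimately show ?thesis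
        using AB by (cases "homogeneous G A B") (auto simp: F_def close_pairs_def)
    qed
  qed
next
  have "close_pairs G P \<subseteq> close_pairs G P'"
  proof
    fix e assume "e \<in> close_pairs G P"
    then obtain A B where AB: "A \<in> P" "B \<in> P" "A = B \<or> \<not> homogeneous G A B" "e \<in> pairs_between A B"
      by (auto simp: close_pairs_def)
    obtain X Y where XY: "X \<in> P'" "Y \<in> P'" "A \<subseteq> X" "B \<subseteq> Y" "A = B \<Longrightarrow> X = Y"
      using coarse AB(1,2) by metis
    then have "X = Y \<or> \<not> homogeneous G X Y"
      using AB(3) homogeneous_mono by blast
    moreover have "e \<in> pairs_between X Y"
      using AB(4) XY by (auto simp: pairs_between_def)
    ultimately show "e \<in> close_pairs G P'"
      using XY by (auto simp: close_pairs_def)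
  qed
  then show "close_pairs G P \<union> (\<Union>(A, B)\<in>F. pairs_between A B) \<subseteq> close_pairs G P'"
    by (auto simp: F_def)
qed

section \<open>From contraction sequences to construction sequences\<close>

text \<open>The bound 2 on the number of old parts in a new one is the factor 2 in the width: a merge joins
  only two parts at a time.\<close>

lemma
  assumes P: "partition_on V P" and "merges_to P P'"
  shows partition_on_merges_to: "partition_on V P'"
    and merges_to_coarsens: "X \<in> P \<Longrightarrow> \<exists>Y\<in>P'. X \<subseteq> Y"
    and merges_to_fibre: "Y \<in> P' \<Longrightarrow> card {X \<in> P. X \<subseteq> Y} \<le> 2"
proof -
  obtain A B where AB: "A \<in> P" "B \<in> P" "A \<noteq> B" and P': "P' = insert (A \<union> B) (P - {A, B})"
    using assms(2) unfolding merges_to_def by blast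
  have disj: "X \<inter> Y = {}" if "X \<in> P" "Y \<in> P" "X \<noteq> Y" for X Y
    using partition_part_unique[OF P] that by blast
  have ne: "X \<noteq> {}" if "X \<in> P" for X
    using P that by (auto dest: partition_onD3)
  show "partition_on V P'"
  proof (rule partition_onI)
    show "\<Union>P' = V"
      using AB partition_onD1[OF P] by (auto simp: P')
    show "{} \<notin> P'"
      using AB ne by (auto simp: P')
    show "disjnt X Y" if "X \<in> P'" "Y \<in> P'" "X \<noteq> Y" for X Y
      using that AB disj[of A] disj[of B] disj[of X Y] by (auto simp: P' disjnt_def)
  qed
  show "X \<in> P \<Longrightarrow> \<exists>Y\<in>P'. X \<subseteq> Y"
    by (auto simp: P')
  show "card {X \<in> P. X \<subseteq> Y} \<le> 2" if "Y \<in> P'"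
  proof -
    have "{X \<in> P. X \<subseteq> Y} \<subseteq> {A, B} \<or> {X \<in> P. X \<subseteq> Y} \<subseteq> {Y}"
    proof (cases "Y = A \<union> B")
      case True
      have "X = A \<or> X = B" if "X \<in> P" "X \<subseteq> Y" for X
      proof (rule ccontr)
        assume "\<not> (X = A \<or> X = B)"
        then have "X \<inter> A = {}" "X \<inter> B = {}"
          using that AB disj by auto
        then show False
          using that True ne[of X] by blast
      qed
      then show ?thesis
        by blast
    next
      case False
      then have "Y \<in> P"
        using \<open>Y \<in> P'\<close> P' by auto
      have "X = Y" if "X \<in> P" "X \<subseteq> Y" for X
        using that \<open>Y \<in> P\<close> disj[of X Y] ne[of X] by (metis inf.absorb1)
      then show ?thesis
        by blast
    qed
    moreover have "card {A, B} \<le> 2" "card {Y} \<le> 2"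
      by (simp_all add: card_insert_le_m1)
    ultimately show ?thesis
      by (meson card_mono finite.emptyI finite.insertI order_trans)
  qed
qed

definition width_at_most :: "'a set \<Rightarrow> nat \<Rightarrow> nat \<Rightarrow> 'a cstate \<Rightarrow> bool" where
  "width_at_most V r k S \<longleftrightarrow> (\<forall>v\<in>V. card (reachable_parts V r S v) \<le> k)"

lemma width_at_most_close_pairs:
  assumes P: "partition_on (verts G) P" "finite P"
    and deg: "\<And>A. A \<in> P \<Longrightarrow> card (red_neighbours G P A) \<le> d"
  shows "width_at_most (verts G) r (2 * (d + 1) ^ r) (state G P (close_pairs G P))"
proof -
  have "card {X \<in> P. X \<subseteq> Y} \<le> 2" if "Y \<in> P" for Y
  proof -
    have "{X \<in> P. X \<subseteq> Y} \<subseteq> {Y}"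
      using partition_onD3[OF P(1)] partition_part_unique[OF P(1) _ that]
      by (auto simp: subset_iff) (metis all_not_in_conv)+
    then have "card {X \<in> P. X \<subseteq> Y} \<le> card {Y}"
      by (intro card_mono) auto
    then show ?thesis
      by simp
  qed
  then show ?thesis
    unfolding width_at_most_def
    by (intro ballI card_reachable_parts[OF P deg order_refl P(2)]) auto
qed

text \<open>The newly close pairs are resolved while the partition is still \<open>P\<close>, where they are unions of
  homogeneous pairs of parts; after the merge they could be mixed and no longer resolvable.\<close>

lemma steps_within_merge:
  assumes V: "finite (verts G)" and P: "partition_on (verts G) P" and m: "merges_to P P'"
    and deg: "\<And>A. A \<in> P' \<Longrightarrow> card (red_neighbours G P' A) \<le> d"
  shows "steps_within (width_at_most (verts G) r (2 * (d + 1) ^ r))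
           (state G P (close_pairs G P)) (state G P' (close_pairs G P'))"
    (is "steps_within ?Q _ _")
proof -
  note P' = partition_on_merges_to[OF P m]
  have fin: "finite P" "finite P'"
    using V P P' by (auto intro: finite_elements)
  have width: "?Q (state G P R)" if "R \<subseteq> close_pairs G P'" for R
    unfolding width_at_most_def
    by (intro ballI card_reachable_parts[OF P' fin(2) deg that fin(1) merges_to_coarsens[OF P m]
          merges_to_fibre[OF P m]])
  let ?F = "{(A, B). A \<in> P \<and> B \<in> P \<and> homogeneous G A B \<and> pairs_between A B \<subseteq> close_pairs G P'}"
  have F: "close_pairs G P' = close_pairs G P \<union> (\<Union>(A, B)\<in>?F. pairs_between A B)"
    using partition_onD1[OF P] partition_onD1[OF P'] merges_to_coarsens[OF P m]
    by (intro close_pairs_coarsening[OF _ P']) auto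
  have "finite ?F"
    by (rule finite_subset[of _ "P \<times> P"]) (use fin in auto)
  then have "steps_within ?Q (state G P (close_pairs G P)) (state G P (close_pairs G P'))"
    by (subst F, intro resolve_homogeneous_pairs, unfold F[symmetric])
      (use width partition_onD1[OF P] in auto)
  moreover have "construction_step (state G P (close_pairs G P')) (state G P' (close_pairs G P'))"
    using merge[of "state G P (close_pairs G P')" P'] m by (simp add: state_def)
  ultimately show ?thesis
    using width_at_most_close_pairs[OF P' fin(2) deg]
    by (auto intro: rtranclp.rtrancl_into_rtrancl)
qed

lemma steps_within_contractions:
  assumes V: "finite (verts G)"
    and "Ps \<noteq> []" "partition_on (verts G) (hd Ps)" "successively merges_to Ps"
    and "\<And>P A. P \<in> set Ps \<Longrightarrow> A \<in> P \<Longrightarrow> card (red_neighbours G P A) \<le> d"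
  shows "steps_within (width_at_most (verts G) r (2 * (d + 1) ^ r))
           (state G (hd Ps) (close_pairs G (hd Ps))) (state G (last Ps) (close_pairs G (last Ps)))"
  using assms(2-)
proof (induction Ps rule: induct_list012)
  case (3 P P' Ps)
  have "merges_to P P'"
    using 3 by simp
  then have "steps_within (width_at_most (verts G) r (2 * (d + 1) ^ r))
           (state G P (close_pairs G P)) (state G P' (close_pairs G P'))"
    using 3 by (intro steps_within_merge V) auto
  also have "steps_within (width_at_most (verts G) r (2 * (d + 1) ^ r))
      (state G P' (close_pairs G P')) (state G (last (P' # Ps)) (close_pairs G (last (P' # Ps))))"
    using 3 partition_on_merges_to[of "verts G" P P'] by simp
  finally show ?case
    by simp
next
  case (2 P)
  show ?case
    by simp
qed simp

lemma steps_within_list: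
  assumes "steps_within Q S T" "Q S"
  shows "\<exists>Ss. Ss \<noteq> [] \<and> hd Ss = S \<and> last Ss = T \<and> successively construction_step Ss \<and>
    (\<forall>S\<in>set Ss. Q S)"
  using assms
proof (induction rule: converse_rtranclp_induct)
  case base
  show ?case
    by (rule exI[of _ "[T]"]) (simp add: base)
next
  case (step S S')
  then obtain Ss where Ss: "Ss \<noteq> []" "hd Ss = S'" "last Ss = T" "successively construction_step Ss"
    "\<forall>S\<in>set Ss. Q S"
    by blast
  show ?case
    by (rule exI[of _ "S # Ss"]) (use Ss step.hyps(1) step.prems in \<open>simp add: successively_Cons\<close>)
qed

lemma partition_on_singleton_parts: "partition_on V (singletons V)"
  using partition_on_singletons[of V] by (simp add: singletons_def image_def Bex_def conj_commute)

lemma merge_width_le: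
  assumes G: "simple_graph G" and "twin_width G \<le> enat d"
  shows "merge_width r G \<le> enat (2 * (d + 1) ^ r)"
proof -
  let ?V = "verts G" and ?k = "2 * (d + 1) ^ r"
  have V: "finite ?V" and E: "edges G \<subseteq> [?V]\<^bsup>2\<^esup>"
    using G by (auto simp: simple_graph_def)
  \<comment> \<open>A strict bound yields a contraction sequence without having to show that the infimum is attained.\<close>
  have "twin_width G < enat (Suc d)"
    using assms(2) by (simp add: order_le_less_trans)
  then obtain d' Ps where "d' < Suc d" and Ps: "contraction_sequence G Ps" "red_degree_at_most G Ps d'"
    unfolding twin_width_def INF_less_iff enat_ord_simps by blast
  then have deg: "card (red_neighbours G P A) \<le> d" if "P \<in> set Ps" "A \<in> P" for P A
  proof -
    have "A \<in> verts (red_graph G P)"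
      using that by (simp add: red_graph_def)
    then have "degree (red_graph G P) A \<le> d'"
      using Ps(2) that unfolding red_degree_at_most_def by blast
    then show ?thesis
      using \<open>d' < Suc d\<close> by (simp add: card_red_neighbours[OF \<open>A \<in> P\<close>])
  qed
  have ne: "Ps \<noteq> []" and hd: "hd Ps = singletons ?V" and last: "trivial_partition ?V (last Ps)"
    and succ: "successively merges_to Ps"
    using Ps(1) by (auto simp: contraction_sequence_def)
  have init: "state G (singletons ?V) (close_pairs G (singletons ?V)) = initial_state ?V"
    by (simp add: state_def initial_state_def close_pairs_singletons)
  have "steps_within (width_at_most ?V r ?k) (initial_state ?V)
      (state G (last Ps) (close_pairs G (last Ps)))"
    using steps_within_contractions[OF V ne _ succ deg] partition_on_singleton_parts[of ?V]
    unfolding hd init by simp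
  moreover have "width_at_most ?V r ?k (initial_state ?V)"
  proof -
    have "hd Ps \<in> set Ps"
      using ne by simp
    then have "card (red_neighbours G (singletons ?V) A) \<le> d" if "A \<in> singletons ?V" for A
      using deg that hd by simp
    then show ?thesis
      unfolding init[symmetric]
      by (intro width_at_most_close_pairs partition_on_singleton_parts
          finite_elements[OF V partition_on_singleton_parts])
  qed
  ultimately obtain Ss where Ss: "Ss \<noteq> []" "hd Ss = initial_state ?V"
    "last Ss = state G (last Ps) (close_pairs G (last Ps))" "successively construction_step Ss"
    "\<forall>S\<in>set Ss. width_at_most ?V r ?k S"
    using steps_within_list by blast
  have "construction_sequence G Ss"
    using Ss last E unfolding construction_sequence_def
    by (auto simp: state_def close_pairs_trivial[OF last])
  moreover have "radius_width_at_most ?V r Ss ?k"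
    using Ss(5) by (simp add: radius_width_at_most_def width_at_most_def)
  ultimately show ?thesis
    unfolding merge_width_def by (intro INF_lower) auto
qed

theorem theorem1p4:
  fixes \<C> :: "'a graph set"
  assumes "\<forall>G\<in>\<C>. simple_graph G"
    and "bounded_twin_width \<C>"
  shows "bounded_merge_width \<C>"
proof -
  obtain d where "\<forall>G\<in>\<C>. twin_width G \<le> enat d"
    using assms(2) unfolding bounded_twin_width_def by blast
  then have "(SUP G\<in>\<C>. merge_width r G) \<le> enat (2 * (d + 1) ^ r)" for r
    using assms(1) by (intro SUP_least merge_width_le) auto
  then show ?thesis
    unfolding bounded_merge_width_def using enat_ord_simps(4) order_le_less_trans by blast
qed

end
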